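(* Let $\kappa\ge 1$, let $Y\subset\mathbb{R}^\kappa$ be bounded, let $\pi:\mathbb{R}^\kappa\to Y$ be a quotient map, let $f=(f_1,\dots,f_\kappa):Y\to\mathbb{R}^\kappa$ be a continuous section of $\pi$, and let $y\in Y$. The map $(0,t_*(y))\ni t\mapsto iQ_tf(y)$ is locally Lipschitz and locally semiconcave. For all $t\in(0,t_*(y))$ it satisfies $$\frac{d^-}{dt}iQ_tf(y)=-\frac{(iD^-f(y,t))^2}{2t^2},\qquad \frac{d^+}{dt}iQ_tf(y)=-\frac{(iD^+f(y,t))^2}{2t^2},$$ where $\frac{d^-}{dt}$ and $\frac{d^+}{dt}$ denote the left and right derivatives. In particular, $t\mapsto iQ_tf(y)$ is differentiable at $t\in(0,t_*(y))$ if and only if $iD^+f(y,t)=iD^-f(y,t)$.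
   Context: $\mathbb{R}^\kappa$ carries the Euclidean distance $d$, and $Y\subset\mathbb{R}^\kappa$ the subspace topology. A quotient map is a continuous, open and surjective map. A section of $\pi$ is a map $f:Y\to\mathbb{R}^\kappa$ with $\pi\circ f=\mathrm{id}_Y$. For $x\in\mathbb{R}^\kappa$ and $A\subset\mathbb{R}^\kappa$, $d(x,A)=\inf\{d(x,a):a\in A\}$. Intrinsic Hopf-Lax semigroup: for $t>0$ and $y,z\in Y$ put $$F(t,y,z)=\max_{j=1,\dots,\kappa} f_j(z)+\frac1{2t}\,d^2(f(z),\pi^{-1}(y)),\qquad iQ_tf(y)=\inf_{z\in Y}F(t,y,z)\in\mathbb{R}\cup\{-\infty\}.$$ A minimizing sequence for $iQ_tf(y)$ is a sequence $(y_n)$ in $Y$ with $F(t,y,y_n)\to iQ_tf(y)$. Define $$iD^+f(y,t)=\sup\Big\{\limsup_{n\to\infty}d(f(y_n),\pi^{-1}(y))\Big\},\qquad iD^-f(y,t)=\inf\Big\{\liminf_{n\to\infty}d(f(y_n),\pi^{-1}(y))\Big\},$$ where the sup and the inf range over all minimizing sequences $(y_n)$ for $iQ_tf(y)$. Define $t_*(y)=\sup\{t>0: iQ_tf(y)>-\infty\}\in[0,+\infty]$, with $t_*(y)=0$ if $iQ_tf(y)=-\infty$ for all $t>0$. A function on an open interval is locally semiconcave if, near each point, it is the sum of a concave function and a quadratic function. *)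

theory Defs
  imports "HOL-Analysis.Analysis"
begin

text \<open>Stronger than the library's \<open>quotient_map\<close>: openness of the map is part of the notion.\<close>

definition open_quotient_map :: "'a::topological_space set \<Rightarrow> ('a \<Rightarrow> 'a) \<Rightarrow> bool" where
  "open_quotient_map Y \<pi> \<longleftrightarrow>
     continuous_map euclidean (top_of_set Y) \<pi> \<and>
     open_map euclidean (top_of_set Y) \<pi> \<and>
     \<pi> ` UNIV = Y"

definition section_of :: "'a set \<Rightarrow> ('a \<Rightarrow> 'a) \<Rightarrow> ('a \<Rightarrow> 'a) \<Rightarrow> bool" where
  "section_of Y \<pi> f \<longleftrightarrow> (\<forall>y\<in>Y. \<pi> (f y) = y)"

definition hl_F :: "(real^'n \<Rightarrow> real^'n) \<Rightarrow> (real^'n \<Rightarrow> real^'n) \<Rightarrow> real \<Rightarrow> real^'n \<Rightarrow> real^'n \<Rightarrow> real"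
  where "hl_F \<pi> f t y z = (MAX j. f z $ j) + 1 / (2 * t) * (infdist (f z) (\<pi> -` {y}))\<^sup>2"

definition iQ :: "(real^'n) set \<Rightarrow> (real^'n \<Rightarrow> real^'n) \<Rightarrow> (real^'n \<Rightarrow> real^'n) \<Rightarrow> real \<Rightarrow> real^'n \<Rightarrow> ereal"
  where "iQ Y \<pi> f t y = (INF z\<in>Y. ereal (hl_F \<pi> f t y z))"

definition minimizing_seq ::
    "(real^'n) set \<Rightarrow> (real^'n \<Rightarrow> real^'n) \<Rightarrow> (real^'n \<Rightarrow> real^'n) \<Rightarrow> real \<Rightarrow> real^'n \<Rightarrow> (nat \<Rightarrow> real^'n) \<Rightarrow> bool"
  where "minimizing_seq Y \<pi> f t y u \<longleftrightarrow>
     (\<forall>n. u n \<in> Y) \<and> (\<lambda>n. ereal (hl_F \<pi> f t y (u n))) \<longlonglongrightarrow> iQ Y \<pi> f t y"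

definition iD_plus ::
    "(real^'n) set \<Rightarrow> (real^'n \<Rightarrow> real^'n) \<Rightarrow> (real^'n \<Rightarrow> real^'n) \<Rightarrow> real^'n \<Rightarrow> real \<Rightarrow> ereal"
  where "iD_plus Y \<pi> f y t =
     (SUP u\<in>{u. minimizing_seq Y \<pi> f t y u}. limsup (\<lambda>n. ereal (infdist (f (u n)) (\<pi> -` {y}))))"

definition iD_minus ::
    "(real^'n) set \<Rightarrow> (real^'n \<Rightarrow> real^'n) \<Rightarrow> (real^'n \<Rightarrow> real^'n) \<Rightarrow> real^'n \<Rightarrow> real \<Rightarrow> ereal"
  where "iD_minus Y \<pi> f y t =
     (INF u\<in>{u. minimizing_seq Y \<pi> f t y u}. liminf (\<lambda>n. ereal (infdist (f (u n)) (\<pi> -` {y}))))"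

text \<open>The case distinction is needed since \<^term>\<open>Sup {} = (-\<infinity>::ereal)\<close>.\<close>

definition t_star :: "(real^'n) set \<Rightarrow> (real^'n \<Rightarrow> real^'n) \<Rightarrow> (real^'n \<Rightarrow> real^'n) \<Rightarrow> real^'n \<Rightarrow> ereal"
  where "t_star Y \<pi> f y =
     (if \<forall>t>0. iQ Y \<pi> f t y = -\<infinity> then 0
      else Sup {ereal t | t. t > 0 \<and> iQ Y \<pi> f t y > -\<infinity>})"

definition locally_lipschitz_on :: "real set \<Rightarrow> (real \<Rightarrow> real) \<Rightarrow> bool" where
  "locally_lipschitz_on I g \<longleftrightarrow>
     (\<forall>t\<in>I. \<exists>e>0. \<exists>L. L-lipschitz_on (ball t e \<inter> I) g)"

text \<open>Intended for open \<open>I\<close>.\<close>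

definition locally_semiconcave_on :: "real set \<Rightarrow> (real \<Rightarrow> real) \<Rightarrow> bool" where
  "locally_semiconcave_on I g \<longleftrightarrow>
     (\<forall>t\<in>I. \<exists>e>0. ball t e \<subseteq> I \<and>
        (\<exists>h a b c. concave_on (ball t e) h \<and>
           (\<forall>s\<in>ball t e. g s = h s + (a * s\<^sup>2 + b * s + c))))"

end

theory Submission
  imports Defs
begin

text \<open>
  For fixed \<open>y\<close> put \<open>s = 1 / (2 * t)\<close>. Then the functional to be minimized is \<open>a z + s * b z\<close>, where
  \<open>a z\<close> is the maximal coordinate of \<open>f z\<close> and \<open>b z \<ge> 0\<close> is the squared distance from \<open>f z\<close> to the
  fibre over \<open>y\<close>. So the semigroup is an infimum of functions that are affine in \<open>s\<close>, hence a concave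
  function of \<open>s\<close>, and since \<open>b \<ge> 0\<close> it is finite for all times before one at which it is finite.

  A concave function has one-sided derivatives. For an infimum of affine functions they are the
  extreme slopes of the almost optimal members: the right derivative is the smallest, and the left
  derivative the largest, limit of \<open>b\<close> along minimizing sequences
  (\<open>affine_inf_right_derivative\<close>, \<open>affine_inf_left_derivative\<close>). These limits are the
  squares of \<^const>\<open>iD_minus\<close> and \<^const>\<open>iD_plus\<close>
  (\<open>INF_liminf_eq_sqrt\<close>, \<open>SUP_limsup_eq_sqrt\<close>). The decreasing substitution \<open>s = 1 / (2 * t)\<close>
  swaps the two sides and contributes the factor \<open>- 1 / (2 * t\<^sup>2)\<close>. The criterion for
  differentiability follows, because both quantities are nonnegative.

  Local regularity comes from a uniform bound: strictly before a time at which the semigroup is finite,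
  almost optimal members have bounded slope (\<open>near_minimizers_bounded\<close>). Locally in time the
  semigroup is therefore an infimum of functions \<open>a z + b z / (2 * t)\<close> with \<open>b z \<le> B\<close>. These have a
  common Lipschitz constant and a common upper bound on the second derivative, and both
  properties pass to the infimum.
\<close>

section \<open>Infima of families of affine functions\<close>

definition affine_inf :: "'z set \<Rightarrow> ('z \<Rightarrow> real) \<Rightarrow> ('z \<Rightarrow> real) \<Rightarrow> real \<Rightarrow> real" where
  "affine_inf Z a b s = (INF z\<in>Z. a z + s * b z)"

definition affine_bdd :: "'z set \<Rightarrow> ('z \<Rightarrow> real) \<Rightarrow> ('z \<Rightarrow> real) \<Rightarrow> real \<Rightarrow> bool" where
  "affine_bdd Z a b s \<longleftrightarrow> bdd_below ((\<lambda>z. a z + s * b z) ` Z)"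

definition affine_minimizing ::
    "'z set \<Rightarrow> ('z \<Rightarrow> real) \<Rightarrow> ('z \<Rightarrow> real) \<Rightarrow> real \<Rightarrow> (nat \<Rightarrow> 'z) \<Rightarrow> bool" where
  "affine_minimizing Z a b s u \<longleftrightarrow>
     (\<forall>n. u n \<in> Z) \<and> (\<lambda>n. a (u n) + s * b (u n)) \<longlonglongrightarrow> affine_inf Z a b s"

lemma affine_inf_lower:
  assumes "affine_bdd Z a b s" "z \<in> Z"
  shows "affine_inf Z a b s \<le> a z + s * b z"
  using assms unfolding affine_bdd_def affine_inf_def by (auto intro: cINF_lower)

lemma affine_inf_approx:
  assumes "affine_bdd Z a b s" "Z \<noteq> {}" "0 < \<epsilon>"
  obtains z where "z \<in> Z" "a z + s * b z < affine_inf Z a b s + \<epsilon>"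
  using cINF_less_iff[of Z "\<lambda>z. a z + s * b z" "affine_inf Z a b s + \<epsilon>"] assms
  unfolding affine_bdd_def affine_inf_def by auto

text \<open>Raising the parameter only adds a nonnegative quantity. In terms of time this says that
  finiteness of the semigroup at one time implies finiteness at all earlier times.\<close>
lemma affine_bdd_mono:
  assumes "affine_bdd Z a b s" "s \<le> r" "\<And>z. z \<in> Z \<Longrightarrow> 0 \<le> b z"
  shows "affine_bdd Z a b r"
proof -
  obtain m where m: "\<And>z. z \<in> Z \<Longrightarrow> m \<le> a z + s * b z"
    using assms(1) unfolding affine_bdd_def bdd_below_def by auto
  have "m \<le> a z + r * b z" if "z \<in> Z" for z
    using m[OF that] mult_right_mono[OF assms(2) assms(3)[OF that]] by linarith
  then show ?thesis unfolding affine_bdd_def bdd_below_def by blast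
qed

lemma affine_inf_concave:
  assumes "convex J" "Z \<noteq> {}" "\<And>s. s \<in> J \<Longrightarrow> affine_bdd Z a b s"
  shows "concave_on J (affine_inf Z a b)"
  unfolding concave_on_iff
proof (intro conjI ballI allI impI assms(1))
  fix x y u v :: real
  assume xy: "x \<in> J" "y \<in> J" and uv: "0 \<le> u" "0 \<le> v" "u + v = 1"
  have "u * affine_inf Z a b x + v * affine_inf Z a b y \<le> a z + (u * x + v * y) * b z"
    if z: "z \<in> Z" for z
  proof -
    have "u * affine_inf Z a b x + v * affine_inf Z a b y
        \<le> u * (a z + x * b z) + v * (a z + y * b z)"
      by (intro add_mono mult_left_mono affine_inf_lower assms xy z uv)
    also have "\<dots> = (u + v) * a z + (u * x + v * y) * b z"
      by (simp add: algebra_simps)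
    finally show ?thesis using uv by simp
  qed
  then show "u * affine_inf Z a b x + v * affine_inf Z a b y
      \<le> affine_inf Z a b (u *\<^sub>R x + v *\<^sub>R y)"
    unfolding affine_inf_def[of Z a b "u *\<^sub>R x + v *\<^sub>R y"]
    using assms(2) by (auto intro: cINF_greatest)
qed

section \<open>One-sided derivatives of the infimum\<close>

text \<open>The difference quotients at \<open>s\<close> decrease as the right endpoint moves away from \<open>s\<close>,
  and the slope of any chord ending at \<open>s\<close> from the left bounds them from above, so they converge.\<close>
lemma concave_on_right_derivative:
  fixes \<phi> :: "real \<Rightarrow> real"
  assumes conc: "concave_on {l<..<r} \<phi>" and s: "l < s" "s < r"
  shows "\<exists>p. (\<phi> has_real_derivative p) (at_right s)"
proof -
  define q where "q x = (\<phi> x - \<phi> s) / (x - s)" for x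
  have cv: "convex_on {l<..<r} (\<lambda>x. - \<phi> x)"
    using conc by (simp add: concave_on_def)
  have neg: "(- \<phi> x - - \<phi> w) / (x - w) = - ((\<phi> x - \<phi> w) / (x - w))" for x w
    by (simp add: minus_divide_left)
  have swap: "(\<phi> s - \<phi> x) / (s - x) = q x" for x
    unfolding q_def by (metis minus_diff_eq minus_divide_divide)
  obtain w where w: "l < w" "w < s" using dense s(1) by blast
  have mono: "- q x \<le> - q z" if "x \<in> {l<..<r}" "z \<in> {l<..<r}" "s < x" "x \<le> z" for x z
  proof (cases "x = z")
    case False
    then have "(- \<phi> s - - \<phi> x) / (s - x) \<le> (- \<phi> s - - \<phi> z) / (s - z)"
      using that s by (intro convex_on_slope_le(1)[OF cv]) auto
    then show ?thesis unfolding neg swap .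
  qed simp
  have bnd: "- q w \<le> - q x" if "x \<in> {l<..<r}" "s < x" for x
  proof -
    have "(- \<phi> w - - \<phi> s) / (w - s) \<le> (- \<phi> s - - \<phi> x) / (s - x)"
      using order_trans[OF convex_on_slope_le[OF cv, of w x s]] that s w by auto
    then show ?thesis unfolding neg swap q_def[of w, symmetric] .
  qed
  have "((\<lambda>x. - q x) \<longlongrightarrow> Inf ((\<lambda>x. - q x) ` ({s<..} \<inter> {l<..<r}))) (at s within ({s<..} \<inter> {l<..<r}))"
    using mono bnd by (rule Lim_right_bound)
  moreover have "at s within ({s<..} \<inter> {l<..<r}) = at_right s"
    using s by (intro at_within_nhd[where S="{l<..<r}"]) auto
  ultimately obtain L where "((\<lambda>x. - q x) \<longlongrightarrow> L) (at_right s)" by auto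
  then have "(q \<longlongrightarrow> - L) (at_right s)" using tendsto_minus[of "\<lambda>x. - q x" L] by simp
  then show ?thesis unfolding has_field_derivative_iff q_def by blast
qed

text \<open>An envelope theorem: the right derivative \<open>p\<close> is the smallest limit of slopes along
  minimizing sequences, and it is attained. For \<open>r > s\<close> the value at \<open>r\<close> lies below every affine
  member, so the difference quotient from \<open>s\<close> to \<open>r\<close> is, up to a vanishing error, at most
  \<open>b (u n)\<close> for each sequence \<open>u\<close> minimizing at \<open>s\<close>; this gives the lower bound on the slopes.
  For attainment, \<open>u n\<close> is almost optimal at a parameter \<open>s + \<delta> n\<close> with \<open>\<delta> n\<close> tending to \<open>0\<close>
  from the right. Comparing with the value at \<open>s\<close> bounds \<open>b (u n)\<close> by the difference quotient
  plus an error, provided that the optimality gap is small compared with \<open>\<delta> n\<close>.\<close>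
lemma affine_inf_right_derivative:
  assumes ne: "Z \<noteq> {}" and bdd: "\<And>r. l < r \<Longrightarrow> r < h \<Longrightarrow> affine_bdd Z a b r"
    and s: "l < s" "s < h"
  shows "\<exists>p. (affine_inf Z a b has_real_derivative p) (at_right s) \<and>
    (\<forall>u. affine_minimizing Z a b s u \<longrightarrow> (\<forall>c<p. \<forall>\<^sub>F n in sequentially. c < b (u n))) \<and>
    (\<exists>u. affine_minimizing Z a b s u \<and> (\<lambda>n. b (u n)) \<longlonglongrightarrow> p)"
proof -
  define E where "E = affine_inf Z a b"
  define q where "q x = (E x - E s) / (x - s)" for x
  have "concave_on {l<..<h} E"
    unfolding E_def using ne bdd by (intro affine_inf_concave) auto
  then obtain p where p: "(E has_real_derivative p) (at_right s)"
    using concave_on_right_derivative[OF _ s] by blast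
  then have qp: "(q \<longlongrightarrow> p) (at_right s)"
    unfolding has_field_derivative_iff q_def .
  have lower: "E r \<le> a z + r * b z" if "l < r" "r < h" "z \<in> Z" for r z
    unfolding E_def by (intro affine_inf_lower bdd that)
  have ev_lower: "\<forall>\<^sub>F n in sequentially. c < b (u n)"
    if u: "affine_minimizing Z a b s u" and c: "c < p" for u c
  proof -
    have "\<forall>\<^sub>F r in at_right s. r \<in> {s<..<h}"
      using s(2) by (rule eventually_at_right_real)
    with order_tendstoD(1)[OF qp c] have "\<forall>\<^sub>F r in at_right s. c < q r \<and> r \<in> {s<..<h}"
      by (rule eventually_conj)
    then have "\<exists>r. c < q r \<and> r \<in> {s<..<h}"
      by (rule eventually_happens'[OF trivial_limit_at_right_real])
    then obtain r where r: "c < q r" "s < r" "r < h" by auto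
    have lim: "(\<lambda>n. a (u n) + s * b (u n)) \<longlonglongrightarrow> E s" and uZ: "\<And>n. u n \<in> Z"
      using u unfolding affine_minimizing_def E_def by auto
    have "(\<lambda>n. (E r - (a (u n) + s * b (u n))) / (r - s)) \<longlonglongrightarrow> q r"
      unfolding q_def using r by (intro tendsto_divide tendsto_diff tendsto_const lim) simp
    then have "\<forall>\<^sub>F n in sequentially. c < (E r - (a (u n) + s * b (u n))) / (r - s)"
      using r(1) by (rule order_tendstoD(1))
    then show ?thesis
    proof eventually_elim
      case (elim n)
      have "E r - (a (u n) + s * b (u n)) \<le> b (u n) * (r - s)"
        using lower[of r "u n"] uZ r s by (simp add: algebra_simps)
      then have "(E r - (a (u n) + s * b (u n))) / (r - s) \<le> b (u n)"
        using r by (simp add: divide_le_eq)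
      with elim show ?case by linarith
    qed
  qed
  define R where "R = (s + h) / 2"
  have R: "s < R" "R < h" using s by (auto simp: R_def)
  define \<rho> where "\<rho> n = s + (R - s) / real (Suc (Suc n))" for n
  have \<rho>s: "s < \<rho> n" for n using R unfolding \<rho>_def by simp
  have \<rho>R: "\<rho> n < R" for n
  proof -
    have "(R - s) / real (Suc (Suc n)) < (R - s) / 1"
      using R by (intro divide_strict_left_mono) auto
    then show ?thesis by (simp add: \<rho>_def)
  qed
  have \<rho>lim: "\<rho> \<longlonglongrightarrow> s"
    unfolding \<rho>_def
    using tendsto_add[OF tendsto_const LIMSEQ_Suc[OF LIMSEQ_Suc[OF lim_const_over_n[of "R - s"]]], of s]
    by simp
  have "filterlim \<rho> (at_right s) sequentially"
    unfolding filterlim_at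
    by (simp add: \<rho>lim \<rho>s less_imp_neq[OF \<rho>s, symmetric])
  then have q\<rho>: "(\<lambda>n. q (\<rho> n)) \<longlonglongrightarrow> p"
    by (rule filterlim_compose[OF qp])
  define \<delta> where "\<delta> n = \<rho> n - s" for n
  have \<delta>lim: "\<delta> \<longlonglongrightarrow> 0" unfolding \<delta>_def using tendsto_diff[OF \<rho>lim tendsto_const, of s] by simp
  have \<delta>0: "0 < \<delta> n" for n using \<rho>s by (simp add: \<delta>_def)
  have E\<rho>: "E (\<rho> n) = E s + \<delta> n * q (\<rho> n)" for n
    using \<delta>0[of n] unfolding \<delta>_def q_def by simp
  have E\<rho>lim: "(\<lambda>n. E (\<rho> n)) \<longlonglongrightarrow> E s"
    unfolding E\<rho> using tendsto_add[OF tendsto_const tendsto_mult[OF \<delta>lim q\<rho>], of "E s"] by simp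
  \<comment> \<open>The gap \<open>(\<delta> n)\<^sup>2\<close> still vanishes after division by the step \<open>\<delta> n\<close>.\<close>
  have "\<exists>z\<in>Z. a z + \<rho> n * b z < E (\<rho> n) + (\<delta> n)\<^sup>2" for n
  proof -
    have "l < \<rho> n" "\<rho> n < h" using \<rho>s[of n] \<rho>R[of n] R s by auto
    then have "affine_bdd Z a b (\<rho> n)" by (rule bdd)
    moreover have "0 < (\<delta> n)\<^sup>2" using \<delta>0[of n] by simp
    ultimately obtain z where "z \<in> Z" "a z + \<rho> n * b z < affine_inf Z a b (\<rho> n) + (\<delta> n)\<^sup>2"
      using affine_inf_approx ne by blast
    then show ?thesis unfolding E_def by blast
  qed
  then obtain u where uZ: "\<And>n. u n \<in> Z"
    and u: "\<And>n. a (u n) + \<rho> n * b (u n) < E (\<rho> n) + (\<delta> n)\<^sup>2" by metis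
  have shift: "a (u n) + s * b (u n) = a (u n) + \<rho> n * b (u n) - \<delta> n * b (u n)" for n
    by (simp add: \<delta>_def algebra_simps)
  have min: "affine_minimizing Z a b s u"
    unfolding affine_minimizing_def E_def[symmetric]
  proof (intro conjI allI uZ)
    \<comment> \<open>The slopes are bounded below by comparison with the fixed parameter \<open>R\<close> on the far side
        of \<open>\<rho> n\<close>; hence \<open>\<delta> n * b (u n)\<close> cannot be very negative, and \<open>u\<close> is minimizing at \<open>s\<close> too.\<close>
    define m where "m n = (E R - E (\<rho> n) - (\<delta> n)\<^sup>2) / (R - \<rho> n)" for n
    have m: "m n \<le> b (u n)" for n
    proof -
      have "E R \<le> a (u n) + R * b (u n)" using lower R s uZ by auto
      then have "E R - E (\<rho> n) - (\<delta> n)\<^sup>2 \<le> b (u n) * (R - \<rho> n)"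
        using u[of n] by (simp add: algebra_simps)
      then show ?thesis unfolding m_def using \<rho>R[of n] by (simp add: divide_le_eq)
    qed
    have "m \<longlonglongrightarrow> (E R - E s - 0\<^sup>2) / (R - s)"
      unfolding m_def using R by (intro tendsto_intros E\<rho>lim \<delta>lim \<rho>lim) auto
    then have lim: "(\<lambda>n. E (\<rho> n) + (\<delta> n)\<^sup>2 - \<delta> n * m n) \<longlonglongrightarrow> E s + 0\<^sup>2 - 0 * ((E R - E s - 0\<^sup>2) / (R - s))"
      by (intro tendsto_intros E\<rho>lim \<delta>lim)
    show "(\<lambda>n. a (u n) + s * b (u n)) \<longlonglongrightarrow> E s"
    proof (rule tendsto_sandwich[OF _ _ tendsto_const])
      show "\<forall>\<^sub>F n in sequentially. E s \<le> a (u n) + s * b (u n)"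
        using lower s uZ by auto
      show "\<forall>\<^sub>F n in sequentially. a (u n) + s * b (u n) \<le> E (\<rho> n) + (\<delta> n)\<^sup>2 - \<delta> n * m n"
      proof (rule always_eventually, rule allI)
        fix n
        show "a (u n) + s * b (u n) \<le> E (\<rho> n) + (\<delta> n)\<^sup>2 - \<delta> n * m n"
          using u[of n] shift[of n] mult_left_mono[OF m[of n], of "\<delta> n"] \<delta>0[of n] by linarith
      qed
      show "(\<lambda>n. E (\<rho> n) + (\<delta> n)\<^sup>2 - \<delta> n * m n) \<longlonglongrightarrow> E s" using lim by simp
    qed
  qed
  have upper: "b (u n) \<le> q (\<rho> n) + \<delta> n" for n
  proof -
    have "E s \<le> a (u n) + s * b (u n)" using lower s uZ by auto
    then have "\<delta> n * b (u n) \<le> \<delta> n * (q (\<rho> n) + \<delta> n)"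
      using u[of n] shift[of n] E\<rho>[of n] by (simp add: power2_eq_square algebra_simps)
    then show ?thesis using \<delta>0[of n] by simp
  qed
  have "(\<lambda>n. b (u n)) \<longlonglongrightarrow> p"
  proof (rule order_tendstoI)
    fix c assume "c < p"
    then show "\<forall>\<^sub>F n in sequentially. c < b (u n)" using ev_lower[OF min] by blast
  next
    fix c assume "p < c"
    have "(\<lambda>n. q (\<rho> n) + \<delta> n) \<longlonglongrightarrow> p" using tendsto_add[OF q\<rho> \<delta>lim] by simp
    then have "\<forall>\<^sub>F n in sequentially. q (\<rho> n) + \<delta> n < c"
      using \<open>p < c\<close> by (rule order_tendstoD(2))
    then show "\<forall>\<^sub>F n in sequentially. b (u n) < c"
      by (rule eventually_mono) (rule le_less_trans[OF upper])
  qed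
  with min p ev_lower show ?thesis unfolding E_def by blast
qed

text \<open>Reflecting the parameter, \<open>s \<mapsto> - s\<close> and \<open>b \<mapsto> - b\<close>, preserves the family of affine functions
  and exchanges left with right and smallest with largest slopes.\<close>
lemma affine_inf_left_derivative:
  assumes ne: "Z \<noteq> {}" and bdd: "\<And>r. l < r \<Longrightarrow> r < h \<Longrightarrow> affine_bdd Z a b r"
    and s: "l < s" "s < h"
  shows "\<exists>p. (affine_inf Z a b has_real_derivative p) (at_left s) \<and>
    (\<forall>u. affine_minimizing Z a b s u \<longrightarrow> (\<forall>c>p. \<forall>\<^sub>F n in sequentially. b (u n) < c)) \<and>
    (\<exists>u. affine_minimizing Z a b s u \<and> (\<lambda>n. b (u n)) \<longlonglongrightarrow> p)"
proof -
  let ?b = "\<lambda>z. - b z"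
  have inf: "affine_inf Z a ?b (- r) = affine_inf Z a b r" for r
    by (simp add: affine_inf_def)
  have bdd': "affine_bdd Z a ?b r" if "- h < r" "r < - l" for r
    using bdd[of "- r"] that by (simp add: affine_bdd_def)
  have min: "affine_minimizing Z a ?b (- s) u \<longleftrightarrow> affine_minimizing Z a b s u" for u
    by (simp add: affine_minimizing_def inf)
  obtain p where p: "(affine_inf Z a ?b has_real_derivative p) (at_right (- s))"
    and low: "\<And>u c. affine_minimizing Z a b s u \<Longrightarrow> c < p \<Longrightarrow> \<forall>\<^sub>F n in sequentially. c < - b (u n)"
    and ex: "\<exists>u. affine_minimizing Z a b s u \<and> (\<lambda>n. - b (u n)) \<longlonglongrightarrow> p"
    using affine_inf_right_derivative[OF ne bdd', of "- h" "- l" "- s"] s unfolding min by auto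
  have "((\<lambda>r. (affine_inf Z a b (- r) - affine_inf Z a b s) / (r - - s)) \<longlongrightarrow> p) (at_right (- s))"
    using p inf[of "- r" for r] inf[of s] unfolding has_field_derivative_iff by simp
  then have "((\<lambda>r. - ((affine_inf Z a b (- r) - affine_inf Z a b s) / (r - - s))) \<longlongrightarrow> - p) (at_right (- s))"
    by (rule tendsto_minus)
  moreover have "- ((affine_inf Z a b (- r) - affine_inf Z a b s) / (r - - s))
     = (affine_inf Z a b (- r) - affine_inf Z a b s) / (- r - s)" for r
    by (simp add: minus_divide_right)
  ultimately have "(affine_inf Z a b has_real_derivative - p) (at_left s)"
    unfolding has_field_derivative_iff
    by (simp only: at_left_minus[of s] filterlim_filtermap)
  moreover have "\<forall>\<^sub>F n in sequentially. b (u n) < c"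
    if "affine_minimizing Z a b s u" "- p < c" for u c
    using low[OF that(1), of "- c"] that(2) by simp
  moreover have "\<exists>u. affine_minimizing Z a b s u \<and> (\<lambda>n. b (u n)) \<longlonglongrightarrow> - p"
    using ex tendsto_minus by fastforce
  ultimately show ?thesis by blast
qed

lemma reciprocal_time_has_derivative:
  fixes t :: real
  assumes "0 < t"
  shows "((\<lambda>\<tau>. 1 / (2 * \<tau>)) has_real_derivative - (1 / (2 * t\<^sup>2))) (at t within S)"
  using assms by (auto intro!: derivative_eq_intros simp: power2_eq_square field_simps)

text \<open>As \<open>t \<mapsto> 1 / (2 * t)\<close> is decreasing, one-sided derivatives change sides under the
  substitution.\<close>
lemma left_derivative_reciprocal_time:
  fixes E :: "real \<Rightarrow> real"
  assumes E: "(E has_real_derivative p) (at_right (1 / (2 * t)))" and t: "0 < t"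
  shows "((\<lambda>\<tau>. E (1 / (2 * \<tau>))) has_real_derivative - (p / (2 * t\<^sup>2))) (at_left t)"
proof -
  let ?k = "\<lambda>\<tau>::real. 1 / (2 * \<tau>)"
  have "?k ` {0<..<t} \<subseteq> {?k t<..}"
    by (auto simp: field_simps)
  then have "(E has_real_derivative p) (at (?k t) within ?k ` {0<..<t})"
    by (rule has_field_derivative_subset[OF E])
  from DERIV_image_chain[OF this reciprocal_time_has_derivative[OF t]]
  have "((\<lambda>\<tau>. E (?k \<tau>)) has_real_derivative - (p / (2 * t\<^sup>2))) (at t within {0<..<t})"
    by (simp add: o_def)
  moreover have "at t within {0<..<t} = at_left t"
    using t by (intro at_within_nhd[where S="{0<..}"]) auto
  ultimately show ?thesis by simp
qed

lemma right_derivative_reciprocal_time: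
  fixes E :: "real \<Rightarrow> real"
  assumes E: "(E has_real_derivative p) (at_left (1 / (2 * t)))" and t: "0 < t"
  shows "((\<lambda>\<tau>. E (1 / (2 * \<tau>))) has_real_derivative - (p / (2 * t\<^sup>2))) (at_right t)"
proof -
  let ?k = "\<lambda>\<tau>::real. 1 / (2 * \<tau>)"
  have "?k ` {t<..} \<subseteq> {..<?k t}"
    using t by (auto simp: field_simps)
  then have "(E has_real_derivative p) (at (?k t) within ?k ` {t<..})"
    by (rule has_field_derivative_subset[OF E])
  from DERIV_image_chain[OF this reciprocal_time_has_derivative[OF t]]
  show ?thesis by (simp add: o_def)
qed

lemma one_sided_derivatives_differentiable_iff:
  fixes g :: "real \<Rightarrow> real"
  assumes l: "(g has_real_derivative l) (at_left t)" and r: "(g has_real_derivative r) (at_right t)"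
  shows "g differentiable (at t) \<longleftrightarrow> l = r"
proof
  assume "g differentiable (at t)"
  then obtain D where D: "(g has_real_derivative D) (at t)"
    using real_differentiable_def by blast
  have "l = D" "r = D"
    using l r has_field_derivative_at_within[OF D] unfolding has_field_derivative_iff
    by (auto intro: tendsto_unique[OF trivial_limit_at_left_real] tendsto_unique[OF trivial_limit_at_right_real])
  then show "l = r" by simp
next
  assume "l = r"
  then have "(g has_real_derivative l) (at t)"
    using l r unfolding has_field_derivative_iff filterlim_at_split by simp
  then show "g differentiable (at t)" using real_differentiable_def by blast
qed

section \<open>Uniform regularity in the time variable\<close>

text \<open>If \<open>z\<close> is almost optimal at \<open>r\<close>, then moving back to the smaller parameter \<open>s0\<close>, where the
  infimum is still finite, lowers its value by \<open>(r - s0) * b z\<close>, and this cannot take it below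
  the infimum at \<open>s0\<close>. The gap \<open>s1 - s0\<close> therefore bounds the slopes that matter on
  \<open>{s1..s2}\<close>.\<close>
lemma near_minimizers_bounded:
  assumes ne: "Z \<noteq> {}" and b0: "\<And>z. z \<in> Z \<Longrightarrow> 0 \<le> b z"
    and bdd: "affine_bdd Z a b s0" and s: "s0 < s1"
  shows "\<exists>B\<ge>0. \<forall>r\<in>{s1..s2}. \<forall>\<epsilon>>0. \<exists>z\<in>Z. b z \<le> B \<and> a z + r * b z < affine_inf Z a b r + \<epsilon>"
proof -
  let ?E = "affine_inf Z a b"
  \<comment> \<open>The summand \<open>1\<close> caps the optimality gap, so that \<open>B\<close> does not depend on \<open>\<epsilon>\<close>; the infimum
      at \<open>s2\<close> dominates those on the whole interval because \<open>b\<close> is nonnegative.\<close>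
  define B where "B = max 0 ((?E s2 + 1 - ?E s0) / (s1 - s0))"
  have bd: "affine_bdd Z a b r" if "s0 \<le> r" for r
    by (rule affine_bdd_mono[OF bdd that b0])
  have "\<exists>z\<in>Z. b z \<le> B \<and> a z + r * b z < ?E r + \<epsilon>" if r: "r \<in> {s1..s2}" and e: "0 < \<epsilon>" for r \<epsilon>
  proof -
    obtain z where z: "z \<in> Z" "a z + r * b z < ?E r + min \<epsilon> 1"
      using affine_inf_approx[OF bd ne, of r "min \<epsilon> 1"] r s e by auto
    have "?E r \<le> ?E s2"
      unfolding affine_inf_def
    proof (rule cINF_mono[OF ne])
      show "bdd_below ((\<lambda>z. a z + r * b z) ` Z)" using bd[of r] r s by (simp add: affine_bdd_def)
      show "\<exists>n\<in>Z. a n + r * b n \<le> a m + s2 * b m" if "m \<in> Z" for m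
      proof
        show "a m + r * b m \<le> a m + s2 * b m"
          using mult_right_mono[of r s2 "b m"] b0[OF that] r by simp
      qed (fact that)
    qed
    moreover have "?E s0 \<le> a z + s0 * b z" using affine_inf_lower[OF bdd z(1)] .
    moreover have "(s1 - s0) * b z \<le> (r - s0) * b z"
      using r b0[OF z(1)] by (intro mult_right_mono) auto
    ultimately have "b z * (s1 - s0) \<le> ?E s2 + 1 - ?E s0"
      using z(2) by (simp add: algebra_simps)
    then have "b z \<le> (?E s2 + 1 - ?E s0) / (s1 - s0)"
      by (subst pos_le_divide_eq) (use s in auto)
    then have "b z \<le> B" unfolding B_def by linarith
    moreover have "a z + r * b z < ?E r + \<epsilon>" using z(2) by linarith
    ultimately show ?thesis using z(1) by blast
  qed
  moreover have "0 \<le> B" by (simp add: B_def)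
  ultimately show ?thesis by blast
qed

text \<open>Near \<open>s\<close>-optimality can be achieved by members of slope at most \<open>B\<close>, so that the infimum may
  be computed over these members only.\<close>
definition near_minimized ::
    "'z set \<Rightarrow> ('z \<Rightarrow> real) \<Rightarrow> ('z \<Rightarrow> real) \<Rightarrow> real \<Rightarrow> real \<Rightarrow> bool" where
  "near_minimized Z a b B s \<longleftrightarrow> affine_bdd Z a b s \<and>
     (\<forall>\<epsilon>>0. \<exists>z\<in>Z. b z \<le> B \<and> a z + s * b z < affine_inf Z a b s + \<epsilon>)"

text \<open>The substitution \<open>s = 1 / (2 * t)\<close> reverses the order: the spare time between \<open>t2\<close> and \<open>T\<close> is
  the gap between parameters that bounds the slopes.\<close>
lemma near_minimized_near_time:
  assumes "Z \<noteq> {}" and b0: "\<And>z. z \<in> Z \<Longrightarrow> 0 \<le> b z"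
    and t: "0 < t1" "t2 < T" "t1 \<le> t2" and bdd: "affine_bdd Z a b (1 / (2 * T))"
  shows "\<exists>B\<ge>0. \<forall>t\<in>{t1..t2}. near_minimized Z a b B (1 / (2 * t))"
proof -
  have "1 / (2 * T) < 1 / (2 * t2)" using t by (simp add: field_simps)
  from near_minimizers_bounded[OF assms(1) b0 bdd this, of "1 / (2 * t1)"]
  obtain B where B: "0 \<le> B"
    and near: "\<And>r \<epsilon>. r \<in> {1 / (2 * t2)..1 / (2 * t1)} \<Longrightarrow> 0 < \<epsilon> \<Longrightarrow>
      \<exists>z\<in>Z. b z \<le> B \<and> a z + r * b z < affine_inf Z a b r + \<epsilon>" by auto
  have "near_minimized Z a b B (1 / (2 * t))" if "t \<in> {t1..t2}" for t
  proof -
    have mem: "1 / (2 * t) \<in> {1 / (2 * t2)..1 / (2 * t1)}" and "1 / (2 * T) \<le> 1 / (2 * t)"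
      using that t by (auto simp: field_simps)
    from this(2) have "affine_bdd Z a b (1 / (2 * t))" by (rule affine_bdd_mono[OF bdd _ b0])
    with near[OF mem] show ?thesis unfolding near_minimized_def by simp
  qed
  with B show ?thesis by blast
qed

text \<open>Test the infimum at \<open>r\<close> with a near-minimizer at \<open>t\<close> of slope at most \<open>B\<close>: the value of that
  single member changes by at most \<open>B\<close> times the change of \<open>1 / (2 * t)\<close>.\<close>
lemma affine_inf_time_lipschitz:
  assumes t1: "0 < t1" and B: "0 \<le> B" and b0: "\<And>z. z \<in> Z \<Longrightarrow> 0 \<le> b z"
    and near: "\<And>t. t \<in> {t1..t2} \<Longrightarrow> near_minimized Z a b B (1 / (2 * t))"
  shows "(B / (2 * t1\<^sup>2))-lipschitz_on {t1..t2} (\<lambda>t. affine_inf Z a b (1 / (2 * t)))"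
proof (rule lipschitz_onI)
  let ?G = "\<lambda>t. affine_inf Z a b (1 / (2 * t))"
  show "0 \<le> B / (2 * t1\<^sup>2)" using B by simp
  have *: "?G r \<le> ?G t + B / (2 * t1\<^sup>2) * dist t r" if tr: "t \<in> {t1..t2}" "r \<in> {t1..t2}" for t r
  proof (rule field_le_epsilon)
    fix \<epsilon> :: real assume "0 < \<epsilon>"
    then obtain z where z: "z \<in> Z" "b z \<le> B" "a z + 1 / (2 * t) * b z < ?G t + \<epsilon>"
      using near[OF tr(1)] unfolding near_minimized_def by blast
    have "?G r \<le> a z + 1 / (2 * r) * b z"
      using near[OF tr(2)] z(1) unfolding near_minimized_def by (blast intro: affine_inf_lower)
    moreover have "(1 / (2 * r) - 1 / (2 * t)) * b z \<le> dist t r / (2 * t1\<^sup>2) * B"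
    proof (rule mult_mono)
      have "1 / (2 * r) - 1 / (2 * t) = (t - r) / (2 * (t * r))"
        using tr t1 by (simp add: field_simps)
      also have "\<dots> \<le> dist t r / (2 * (t * r))"
        using tr t1 by (intro divide_right_mono) (auto simp: dist_real_def)
      also have "\<dots> \<le> dist t r / (2 * t1\<^sup>2)"
        using tr t1 by (intro divide_left_mono mult_left_mono) (auto simp: power2_eq_square intro!: mult_mono)
      finally show "1 / (2 * r) - 1 / (2 * t) \<le> dist t r / (2 * t1\<^sup>2)" .
    qed (use z b0 in auto)
    ultimately show "?G r \<le> ?G t + B / (2 * t1\<^sup>2) * dist t r + \<epsilon>"
      using z(3) by (simp add: algebra_simps)
  qed
  show "dist (?G t) (?G r) \<le> B / (2 * t1\<^sup>2) * dist t r"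
    if "t \<in> {t1..t2}" "r \<in> {t1..t2}" for t r
    using *[OF that] *[OF that(2,1)] by (simp add: dist_real_def abs_minus_commute abs_le_iff)
qed

text \<open>The constant is half the largest second derivative \<open>B / t ^ 3\<close> of \<open>B / (2 * t)\<close> on the interval,
  attained at \<open>t1\<close>; one quadratic function thus serves all slopes up to \<open>B\<close>.\<close>
lemma reciprocal_minus_square_concave:
  fixes t1 t2 c B :: real
  assumes t1: "0 < t1" and c: "c \<le> B" and B: "0 \<le> B"
  shows "concave_on {t1..t2} (\<lambda>t. c / (2 * t) - B / (2 * t1 ^ 3) * t\<^sup>2)"
proof (rule f''_le0_imp_concave)
  show "convex {t1..t2}" by simp
  fix t assume t: "t \<in> {t1..t2}"
  then have t0: "0 < t" using t1 by auto
  show "((\<lambda>t. c / (2 * t) - B / (2 * t1 ^ 3) * t\<^sup>2) has_real_derivative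
      - (c / (2 * t\<^sup>2)) - B / (t1 ^ 3) * t) (at t)"
    using t0 t1 by (auto intro!: derivative_eq_intros simp: power2_eq_square field_simps)
  show "((\<lambda>t. - (c / (2 * t\<^sup>2)) - B / (t1 ^ 3) * t) has_real_derivative
      c / t ^ 3 - B / t1 ^ 3) (at t)"
    using t0 t1 by (auto intro!: derivative_eq_intros simp: power2_eq_square power3_eq_cube field_simps)
  have "c / t ^ 3 \<le> B / t ^ 3" using c t0 by (intro divide_right_mono) auto
  also have "\<dots> \<le> B / t1 ^ 3" using t t0 t1 B by (intro divide_left_mono power_mono) auto
  finally show "c / t ^ 3 - B / t1 ^ 3 \<le> 0" by simp
qed

text \<open>After subtraction of a common quadratic function, every member of slope at most \<open>B\<close> is concave in
  time, and an infimum of concave functions is concave.\<close>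
lemma affine_inf_time_semiconcave:
  assumes t1: "0 < t1" and B: "0 \<le> B"
    and near: "\<And>t. t \<in> {t1..t2} \<Longrightarrow> near_minimized Z a b B (1 / (2 * t))"
  shows "concave_on {t1..t2} (\<lambda>t. affine_inf Z a b (1 / (2 * t)) - B / (2 * t1 ^ 3) * t\<^sup>2)"
  unfolding concave_on_iff
proof (intro conjI ballI allI impI)
  let ?G = "\<lambda>t. affine_inf Z a b (1 / (2 * t))"
  let ?C = "B / (2 * t1 ^ 3)"
  show "convex {t1..t2}" by simp
  fix x w u v :: real
  assume xw: "x \<in> {t1..t2}" "w \<in> {t1..t2}" and uv: "0 \<le> u" "0 \<le> v" "u + v = 1"
  define m where "m = u *\<^sub>R x + v *\<^sub>R w"
  have m: "m \<in> {t1..t2}"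
    unfolding m_def using convexD[of "{t1..t2}"] xw uv by blast
  have "u * (?G x - ?C * x\<^sup>2) + v * (?G w - ?C * w\<^sup>2) + ?C * m\<^sup>2 \<le> ?G m"
  proof (rule field_le_epsilon)
    fix \<epsilon> :: real assume "0 < \<epsilon>"
    then obtain z where z: "z \<in> Z" "b z \<le> B" "a z + 1 / (2 * m) * b z < ?G m + \<epsilon>"
      using near[OF m] unfolding near_minimized_def by blast
    have up: "?G t \<le> a z + b z / (2 * t)" if "t \<in> {t1..t2}" for t
      using affine_inf_lower[of Z a b "1 / (2 * t)" z] near[OF that] z(1)
      unfolding near_minimized_def by simp
    have "u * (?G x - ?C * x\<^sup>2) + v * (?G w - ?C * w\<^sup>2)
        \<le> u * (a z + b z / (2 * x) - ?C * x\<^sup>2) + v * (a z + b z / (2 * w) - ?C * w\<^sup>2)"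
      using up xw uv by (intro add_mono mult_left_mono) auto
    also have "\<dots> = (u + v) * a z
        + (u * (b z / (2 * x) - ?C * x\<^sup>2) + v * (b z / (2 * w) - ?C * w\<^sup>2))"
      by (simp only: algebra_simps)
    also have "\<dots> \<le> a z + (b z / (2 * m) - ?C * m\<^sup>2)"
      using reciprocal_minus_square_concave[OF t1 z(2) B, of t2] xw uv
      unfolding concave_on_iff m_def by simp
    finally show "u * (?G x - ?C * x\<^sup>2) + v * (?G w - ?C * w\<^sup>2) + ?C * m\<^sup>2 \<le> ?G m + \<epsilon>"
      using z(3) by simp
  qed
  then show "u * (?G x - ?C * x\<^sup>2) + v * (?G w - ?C * w\<^sup>2)
      \<le> affine_inf Z a b (1 / (2 * (u *\<^sub>R x + v *\<^sub>R w))) - ?C * (u *\<^sub>R x + v *\<^sub>R w)\<^sup>2"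
    unfolding m_def by linarith
qed

section \<open>The extreme limits of the fibre distance\<close>

text \<open>Passes from the slopes, which are squared distances, to the distances in the definitions of
  \<^const>\<open>iD_minus\<close> and \<^const>\<open>iD_plus\<close>.\<close>
lemma INF_liminf_eq_sqrt:
  fixes d :: "'z \<Rightarrow> real"
  assumes d0: "\<And>z. 0 \<le> d z"
    and low: "\<And>u c. u \<in> M \<Longrightarrow> c < p \<Longrightarrow> \<forall>\<^sub>F n in sequentially. c < (d (u n))\<^sup>2"
    and ex: "\<exists>u\<in>M. (\<lambda>n. (d (u n))\<^sup>2) \<longlonglongrightarrow> p"
  shows "(INF u\<in>M. liminf (\<lambda>n. ereal (d (u n)))) = ereal (sqrt p)"
proof (rule antisym)
  obtain u where u: "u \<in> M" "(\<lambda>n. (d (u n))\<^sup>2) \<longlonglongrightarrow> p" using ex by blast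
  have p0: "0 \<le> p" using u(2) by (rule LIMSEQ_le_const) auto
  have "(\<lambda>n. ereal (d (u n))) \<longlonglongrightarrow> ereal (sqrt p)"
    using tendsto_real_sqrt[OF u(2)] d0 by simp
  then show "(INF u\<in>M. liminf (\<lambda>n. ereal (d (u n)))) \<le> ereal (sqrt p)"
    using u(1) by (intro INF_lower2[of u]) (simp_all only: lim_imp_Liminf[OF sequentially_bot] order_refl)
  show "ereal (sqrt p) \<le> (INF u\<in>M. liminf (\<lambda>n. ereal (d (u n))))"
  proof (rule INF_greatest, unfold le_Liminf_iff, intro allI impI)
    fix u c assume v: "u \<in> M" and c: "c < ereal (sqrt p)"
    obtain c' where c': "c < ereal c'" "c' < sqrt p"
      using ereal_dense2[OF c] by auto
    show "\<forall>\<^sub>F n in sequentially. c < ereal (d (u n))"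
    proof (cases "c' < 0")
      case True
      have "c < ereal (d x)" for x
        by (rule less_trans[OF c'(1)]) (use True d0[of x] in simp)
      then show ?thesis by simp
    next
      case False
      then have "c'\<^sup>2 < p" using power_strict_mono[OF c'(2), of 2] p0 by simp
      from low[OF v this] show ?thesis
      proof eventually_elim
        case (elim n)
        then have "c' < d (u n)" by (rule power_less_imp_less_base) (rule d0)
        then show ?case using less_trans[OF c'(1)] by simp
      qed
    qed
  qed
qed

lemma SUP_limsup_eq_sqrt:
  fixes d :: "'z \<Rightarrow> real"
  assumes d0: "\<And>z. 0 \<le> d z"
    and up: "\<And>u c. u \<in> M \<Longrightarrow> p < c \<Longrightarrow> \<forall>\<^sub>F n in sequentially. (d (u n))\<^sup>2 < c"
    and ex: "\<exists>u\<in>M. (\<lambda>n. (d (u n))\<^sup>2) \<longlonglongrightarrow> p"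
  shows "(SUP u\<in>M. limsup (\<lambda>n. ereal (d (u n)))) = ereal (sqrt p)"
proof (rule antisym)
  obtain u where u: "u \<in> M" "(\<lambda>n. (d (u n))\<^sup>2) \<longlonglongrightarrow> p" using ex by blast
  have p0: "0 \<le> p" using u(2) by (rule LIMSEQ_le_const) auto
  have "(\<lambda>n. ereal (d (u n))) \<longlonglongrightarrow> ereal (sqrt p)"
    using tendsto_real_sqrt[OF u(2)] d0 by simp
  then show "ereal (sqrt p) \<le> (SUP u\<in>M. limsup (\<lambda>n. ereal (d (u n))))"
    using u(1) by (intro SUP_upper2[of u]) (simp_all only: lim_imp_Limsup[OF sequentially_bot] order_refl)
  show "(SUP u\<in>M. limsup (\<lambda>n. ereal (d (u n)))) \<le> ereal (sqrt p)"
  proof (rule SUP_least, unfold Limsup_le_iff, intro allI impI)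
    fix u c assume v: "u \<in> M" and c: "ereal (sqrt p) < c"
    obtain c' where c': "ereal c' < c" "sqrt p < c'"
      using ereal_dense2[OF c] by auto
    have c'0: "0 \<le> c'" using real_sqrt_ge_zero[OF p0] c'(2) by linarith
    have "p < c'\<^sup>2" using power_strict_mono[OF c'(2) real_sqrt_ge_zero[OF p0], of 2] p0 by simp
    from up[OF v this] show "\<forall>\<^sub>F n in sequentially. ereal (d (u n)) < c"
    proof eventually_elim
      case (elim n)
      then have "d (u n) < c'" using c'0 by (rule power_less_imp_less_base)
      then show ?case using less_trans[OF _ c'(1)] by simp
    qed
  qed
qed

section \<open>The intrinsic Hopf-Lax semigroup as an infimum of affine functions\<close>

abbreviation max_coord :: "(real^'n \<Rightarrow> real^'n) \<Rightarrow> real^'n \<Rightarrow> real" where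
  "max_coord f z \<equiv> (MAX j. f z $ j)"

abbreviation fibre_dist :: "(real^'n \<Rightarrow> real^'n) \<Rightarrow> (real^'n \<Rightarrow> real^'n) \<Rightarrow> real^'n \<Rightarrow> real^'n \<Rightarrow> real" where
  "fibre_dist \<pi> f y z \<equiv> infdist (f z) (\<pi> -` {y})"

abbreviation hl_bdd where
  "hl_bdd Y \<pi> f y \<equiv> affine_bdd Y (max_coord f) (\<lambda>z. (fibre_dist \<pi> f y z)\<^sup>2)"

abbreviation hl_inf where
  "hl_inf Y \<pi> f y \<equiv> affine_inf Y (max_coord f) (\<lambda>z. (fibre_dist \<pi> f y z)\<^sup>2)"

lemma iQ_finite_imp_bdd:
  assumes "- \<infinity> < iQ Y \<pi> f t y"
  shows "hl_bdd Y \<pi> f y (1 / (2 * t))"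
proof -
  obtain m where "ereal m < iQ Y \<pi> f t y" using ereal_dense2[OF assms] by auto
  then have "m \<le> hl_F \<pi> f t y z" if "z \<in> Y" for z
    using that unfolding iQ_def by (auto dest: less_INF_D)
  then show ?thesis unfolding affine_bdd_def bdd_below_def hl_F_def by blast
qed

lemma iQ_eq_affine_inf:
  assumes "hl_bdd Y \<pi> f y (1 / (2 * t))" "Y \<noteq> {}"
  shows "iQ Y \<pi> f t y = ereal (hl_inf Y \<pi> f y (1 / (2 * t)))"
  unfolding iQ_def hl_F_def affine_inf_def
  using ereal_Inf'[OF assms(1)[unfolded affine_bdd_def]] assms(2) by (simp add: image_comp)

lemma minimizing_seq_iff:
  assumes "hl_bdd Y \<pi> f y (1 / (2 * t))" "Y \<noteq> {}"
  shows "minimizing_seq Y \<pi> f t y u \<longleftrightarrow>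
    affine_minimizing Y (max_coord f) (\<lambda>z. (fibre_dist \<pi> f y z)\<^sup>2) (1 / (2 * t)) u"
  unfolding minimizing_seq_def affine_minimizing_def iQ_eq_affine_inf[OF assms] hl_F_def
  by simp

text \<open>As \<open>t\<close> is positive, the exceptional value \<open>0\<close> of \<^const>\<open>t_star\<close> agrees with there being no later
  time of finiteness.\<close>
lemma less_t_star_iff:
  assumes "0 < t"
  shows "ereal t < t_star Y \<pi> f y \<longleftrightarrow> (\<exists>T>t. - \<infinity> < iQ Y \<pi> f T y)"
proof (cases "\<forall>t>0. iQ Y \<pi> f t y = - \<infinity>")
  case True
  then have "\<not> - \<infinity> < iQ Y \<pi> f T y" if "t < T" for T using that assms by auto
  moreover have "t_star Y \<pi> f y = 0" unfolding t_star_def by (rule if_P) (use True in blast)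
  ultimately show ?thesis using assms by auto
next
  case False
  then have ts: "t_star Y \<pi> f y = Sup {ereal t | t. t > 0 \<and> iQ Y \<pi> f t y > - \<infinity>}"
    unfolding t_star_def by (rule if_not_P)
  show ?thesis unfolding ts less_Sup_iff
  proof
    assume "\<exists>x\<in>{ereal t |t. t > 0 \<and> iQ Y \<pi> f t y > - \<infinity>}. ereal t < x"
    then obtain T where "ereal t < ereal T" "- \<infinity> < iQ Y \<pi> f T y" by blast
    then show "\<exists>T>t. - \<infinity> < iQ Y \<pi> f T y" by (intro exI[of _ T]) simp
  next
    assume "\<exists>T>t. - \<infinity> < iQ Y \<pi> f T y"
    then obtain T where T: "t < T" "- \<infinity> < iQ Y \<pi> f T y" by blast
    then have "0 < T" using assms by linarith
    with T show "\<exists>x\<in>{ereal t |t. t > 0 \<and> iQ Y \<pi> f t y > - \<infinity>}. ereal t < x"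
      by (intro bexI[of _ "ereal T"]) (simp, blast)
  qed
qed

section \<open>Regularity and derivatives of the semigroup\<close>

theorem proposition3p9:
  fixes Y :: "(real^'n) set" and \<pi> f :: "real^'n \<Rightarrow> real^'n" and y :: "real^'n"
  assumes "bounded Y"
    and "open_quotient_map Y \<pi>"
    and "continuous_on Y f"
    and "section_of Y \<pi> f"
    and "y \<in> Y"
  defines "I \<equiv> {t::real. 0 < t \<and> ereal t < t_star Y \<pi> f y}"
    and "g \<equiv> (\<lambda>t::real. real_of_ereal (iQ Y \<pi> f t y))"
  shows "(\<forall>t\<in>I. \<bar>iQ Y \<pi> f t y\<bar> \<noteq> \<infinity>) \<and>
    locally_lipschitz_on I g \<and>
    locally_semiconcave_on I g \<and>
    (\<forall>t\<in>I. \<exists>D. iD_minus Y \<pi> f y t = ereal D \<and>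
       (g has_real_derivative - (D\<^sup>2 / (2 * t\<^sup>2))) (at_left t)) \<and>
    (\<forall>t\<in>I. \<exists>D. iD_plus Y \<pi> f y t = ereal D \<and>
       (g has_real_derivative - (D\<^sup>2 / (2 * t\<^sup>2))) (at_right t)) \<and>
    (\<forall>t\<in>I. g differentiable (at t) \<longleftrightarrow> iD_plus Y \<pi> f y t = iD_minus Y \<pi> f y t)"
proof -
  let ?a = "max_coord f" and ?d = "fibre_dist \<pi> f y"
  let ?b = "\<lambda>z. (?d z)\<^sup>2"
  let ?E = "affine_inf Y ?a ?b"
  have ne: "Y \<noteq> {}" using \<open>y \<in> Y\<close> by blast
  have b0: "0 \<le> ?b z" for z by simp
  have I_iff: "t \<in> I \<longleftrightarrow> 0 < t \<and> (\<exists>T>t. - \<infinity> < iQ Y \<pi> f T y)" for t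
    unfolding I_def mem_Collect_eq by (rule conj_cong[OF refl less_t_star_iff])
  have past: "\<exists>T>t. {0<..<T} \<subseteq> I \<and> affine_bdd Y ?a ?b (1 / (2 * T))" if t: "t \<in> I" for t
  proof -
    obtain T where T: "t < T" "- \<infinity> < iQ Y \<pi> f T y" using iffD1[OF I_iff t] by blast
    have "r \<in> I" if "r \<in> {0<..<T}" for r
      unfolding I_iff using that T(2) by (intro conjI exI[of _ T]) simp_all
    then have "{0<..<T} \<subseteq> I" by (rule subsetI)
    with T(1) iQ_finite_imp_bdd[OF T(2)] show ?thesis by (intro exI[of _ T] conjI)
  qed
  have bdd: "affine_bdd Y ?a ?b (1 / (2 * t))" if t: "t \<in> I" for t
  proof -
    obtain T where T: "t < T" "affine_bdd Y ?a ?b (1 / (2 * T))" using past[OF t] by blast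
    have "1 / (2 * T) \<le> 1 / (2 * t)" using T(1) t[unfolded I_iff] by (simp add: field_simps)
    then show ?thesis by (rule affine_bdd_mono[OF T(2) _ b0])
  qed
  have iQ: "iQ Y \<pi> f t y = ereal (?E (1 / (2 * t)))" if "t \<in> I" for t
    using iQ_eq_affine_inf[OF bdd[OF that] ne] .
  have g: "g t = ?E (1 / (2 * t))" if "t \<in> I" for t
    unfolding g_def iQ[OF that] by simp
  \<comment> \<open>Around \<open>t\<close> choose an interval whose endpoints stay away both from time \<open>0\<close> and from a
      later time \<open>T\<close> at which the semigroup is finite.\<close>
  have loc: "\<exists>t1 t2 B. 0 < t1 \<and> t1 < t \<and> t < t2 \<and> 0 \<le> B \<and> {t1..t2} \<subseteq> I \<and>
      (\<forall>r\<in>{t1..t2}. near_minimized Y ?a ?b B (1 / (2 * r)))" if t: "t \<in> I" for t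
  proof -
    obtain T where T: "t < T" "{0<..<T} \<subseteq> I" "affine_bdd Y ?a ?b (1 / (2 * T))"
      using past[OF t] by blast
    obtain t2 where t2: "t < t2" "t2 < T" using dense T(1) by blast
    have t0: "0 < t" using iffD1[OF I_iff t] by (rule conjunct1)
    then have t1: "0 < t / 2" "t / 2 \<le> t2" "t / 2 < t" using t2 by auto
    obtain B where "0 \<le> B" "\<forall>r\<in>{t / 2..t2}. near_minimized Y ?a ?b B (1 / (2 * r))"
      using near_minimized_near_time[OF ne b0 t1(1) t2(2) t1(2) T(3)] by blast
    moreover have "{t / 2..t2} \<subseteq> I" using T(2) t1 t2 by auto
    ultimately show ?thesis using t1 t2 by blast
  qed
  have ball: "\<exists>e>0. ball t e \<subseteq> {t1..t2}" if "t1 < t" "t < t2" for t t1 t2 :: real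
    using that by (intro exI[of _ "min (t - t1) (t2 - t)"]) (auto simp: dist_real_def)
  have lip: "locally_lipschitz_on I g"
    unfolding locally_lipschitz_on_def
  proof
    fix t assume "t \<in> I"
    then obtain t1 t2 B where *: "0 < t1" "t1 < t" "t < t2" "0 \<le> B" "{t1..t2} \<subseteq> I"
      and near: "\<And>r. r \<in> {t1..t2} \<Longrightarrow> near_minimized Y ?a ?b B (1 / (2 * r))" using loc by metis
    obtain e where e: "0 < e" "ball t e \<subseteq> {t1..t2}" using ball * by blast
    have "(B / (2 * t1\<^sup>2))-lipschitz_on {t1..t2} (\<lambda>t. ?E (1 / (2 * t)))"
      by (rule affine_inf_time_lipschitz[OF *(1,4) b0 near])
    then have "(B / (2 * t1\<^sup>2))-lipschitz_on (ball t e \<inter> I) (\<lambda>t. ?E (1 / (2 * t)))"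
      using e(2) by (auto intro: lipschitz_on_subset)
    then have "(B / (2 * t1\<^sup>2))-lipschitz_on (ball t e \<inter> I) g"
      by (rule lipschitz_on_transform) (simp add: g)
    then show "\<exists>e>0. \<exists>L. L-lipschitz_on (ball t e \<inter> I) g" using e(1) by blast
  qed
  have semi: "locally_semiconcave_on I g"
    unfolding locally_semiconcave_on_def
  proof
    fix t assume "t \<in> I"
    then obtain t1 t2 B where *: "0 < t1" "t1 < t" "t < t2" "0 \<le> B" "{t1..t2} \<subseteq> I"
      and near: "\<And>r. r \<in> {t1..t2} \<Longrightarrow> near_minimized Y ?a ?b B (1 / (2 * r))" using loc by metis
    obtain e where e: "0 < e" "ball t e \<subseteq> {t1..t2}" using ball * by blast
    define C where "C = B / (2 * t1 ^ 3)"
    define k where "k t = ?E (1 / (2 * t)) - C * t\<^sup>2" for t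
    have "concave_on {t1..t2} k"
      unfolding k_def C_def by (rule affine_inf_time_semiconcave[OF *(1,4) near])
    then have "concave_on (ball t e) k"
      using e(2) unfolding concave_on_def by (rule convex_on_subset) simp
    moreover have "\<forall>s\<in>ball t e. g s = k s + (C * s\<^sup>2 + 0 * s + 0)"
      using g e(2) *(5) by (auto simp: k_def)
    moreover have "ball t e \<subseteq> I" using e(2) *(5) by blast
    ultimately show "\<exists>e>0. ball t e \<subseteq> I \<and> (\<exists>h a b c. concave_on (ball t e) h \<and>
           (\<forall>s\<in>ball t e. g s = h s + (a * s\<^sup>2 + b * s + c)))" using e(1) by blast
  qed
  have transfer: "(g has_real_derivative D) (at t within S)"
    if t: "t \<in> I" and D: "((\<lambda>\<tau>. ?E (1 / (2 * \<tau>))) has_real_derivative D) (at t within S)" for t D S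
  proof -
    obtain t1 t2 where *: "t1 < t" "t < t2" "{t1..t2} \<subseteq> I" using loc[OF t] by blast
    obtain e where e: "0 < e" "ball t e \<subseteq> {t1..t2}" using ball * by blast
    have eq: "?E (1 / (2 * \<tau>)) = g \<tau>" if "dist \<tau> t < e" for \<tau>
    proof -
      have "\<tau> \<in> ball t e" using that by (simp add: dist_commute)
      then show ?thesis using e(2) *(3) g by (metis subsetD)
    qed
    have "\<forall>\<^sub>F \<tau> in at t within S. ?E (1 / (2 * \<tau>)) = g \<tau>"
      unfolding eventually_at using e(1) eq by blast
    from has_field_derivative_cong_eventually[OF this] D show ?thesis
      using g[OF t] by simp
  qed
  have derivs: "\<exists>p q. 0 \<le> p \<and> 0 \<le> q \<and>
      iD_minus Y \<pi> f y t = ereal (sqrt p) \<and> (g has_real_derivative - (p / (2 * t\<^sup>2))) (at_left t) \<and>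
      iD_plus Y \<pi> f y t = ereal (sqrt q) \<and> (g has_real_derivative - (q / (2 * t\<^sup>2))) (at_right t)"
    if t: "t \<in> I" for t
  proof -
    obtain T where T: "t < T" "affine_bdd Y ?a ?b (1 / (2 * T))" using past[OF t] by blast
    have t0: "0 < t" using iffD1[OF I_iff t] by (rule conjunct1)
    define s where "s = 1 / (2 * t)"
    have s: "1 / (2 * T) < s" "s < s + 1"
      using T(1) t0 by (auto simp: s_def field_simps)
    have bd: "affine_bdd Y ?a ?b r" if "1 / (2 * T) < r" for r
      by (rule affine_bdd_mono[OF T(2) less_imp_le[OF that] b0])
    have M: "{u. minimizing_seq Y \<pi> f t y u} = {u. affine_minimizing Y ?a ?b s u}"
      unfolding s_def by (simp only: minimizing_seq_iff[OF bdd[OF t] ne])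
    obtain p where p: "(?E has_real_derivative p) (at_right s)"
      and low: "\<And>u c. affine_minimizing Y ?a ?b s u \<Longrightarrow> c < p \<Longrightarrow> \<forall>\<^sub>F n in sequentially. c < ?b (u n)"
      and exp: "\<exists>u. affine_minimizing Y ?a ?b s u \<and> (\<lambda>n. ?b (u n)) \<longlonglongrightarrow> p"
      using affine_inf_right_derivative[OF ne bd s] by blast
    obtain q where q: "(?E has_real_derivative q) (at_left s)"
      and up: "\<And>u c. affine_minimizing Y ?a ?b s u \<Longrightarrow> q < c \<Longrightarrow> \<forall>\<^sub>F n in sequentially. ?b (u n) < c"
      and exq: "\<exists>u. affine_minimizing Y ?a ?b s u \<and> (\<lambda>n. ?b (u n)) \<longlonglongrightarrow> q"
      using affine_inf_left_derivative[OF ne bd s] by blast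
    have nonneg: "0 \<le> c" if lim: "\<exists>u. affine_minimizing Y ?a ?b s u \<and> (\<lambda>n. ?b (u n)) \<longlonglongrightarrow> c" for c
    proof -
      obtain u where "(\<lambda>n. ?b (u n)) \<longlonglongrightarrow> c" using lim by blast
      then show ?thesis by (rule LIMSEQ_le_const) simp
    qed
    have "iD_minus Y \<pi> f y t = ereal (sqrt p)"
      unfolding iD_minus_def M
    proof (rule INF_liminf_eq_sqrt)
      show "\<exists>u\<in>{u. affine_minimizing Y ?a ?b s u}. (\<lambda>n. ?b (u n)) \<longlonglongrightarrow> p"
        using exp by blast
    qed (simp_all add: infdist_nonneg low)
    moreover have "iD_plus Y \<pi> f y t = ereal (sqrt q)"
      unfolding iD_plus_def M
    proof (rule SUP_limsup_eq_sqrt)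
      show "\<exists>u\<in>{u. affine_minimizing Y ?a ?b s u}. (\<lambda>n. ?b (u n)) \<longlonglongrightarrow> q"
        using exq by blast
    qed (simp_all add: infdist_nonneg up)
    moreover have "(g has_real_derivative - (p / (2 * t\<^sup>2))) (at_left t)"
      by (rule transfer[OF t left_derivative_reciprocal_time[OF p[unfolded s_def] t0]])
    moreover have "(g has_real_derivative - (q / (2 * t\<^sup>2))) (at_right t)"
      by (rule transfer[OF t right_derivative_reciprocal_time[OF q[unfolded s_def] t0]])
    ultimately show ?thesis using nonneg[OF exp] nonneg[OF exq] by blast
  qed
  show ?thesis
  proof (intro conjI ballI)
    show "\<bar>iQ Y \<pi> f t y\<bar> \<noteq> \<infinity>" if "t \<in> I" for t using iQ[OF that] by simp
    fix t assume t: "t \<in> I"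
    have t0: "0 < t" using iffD1[OF I_iff t] by (rule conjunct1)
    obtain p q where pq: "0 \<le> p" "0 \<le> q"
      and Dm: "iD_minus Y \<pi> f y t = ereal (sqrt p)"
      and l: "(g has_real_derivative - (p / (2 * t\<^sup>2))) (at_left t)"
      and Dp: "iD_plus Y \<pi> f y t = ereal (sqrt q)"
      and r: "(g has_real_derivative - (q / (2 * t\<^sup>2))) (at_right t)"
      using derivs[OF t] by blast
    show "\<exists>D. iD_minus Y \<pi> f y t = ereal D \<and>
       (g has_real_derivative - (D\<^sup>2 / (2 * t\<^sup>2))) (at_left t)"
      using Dm l pq by (intro exI[of _ "sqrt p"]) simp
    show "\<exists>D. iD_plus Y \<pi> f y t = ereal D \<and>
       (g has_real_derivative - (D\<^sup>2 / (2 * t\<^sup>2))) (at_right t)"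
      using Dp r pq by (intro exI[of _ "sqrt q"]) simp
    show "g differentiable (at t) \<longleftrightarrow> iD_plus Y \<pi> f y t = iD_minus Y \<pi> f y t"
      using one_sided_derivatives_differentiable_iff[OF l r] Dm Dp t0 by auto
  qed (fact lip semi)+
qed

end
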